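(* Let $n\ge1$ and let $\gamma^{(2n)}=\{\gamma_{ij}\}_{i,j\ge0,\,0\le i+j\le 2n}$ be a sequence of complex numbers. If $\gamma^{(2n)}$ is flat, i.e., the moment matrix $M(n)=M(n)(\gamma)$ is positive semidefinite and $\operatorname{rank}M(n)=\operatorname{rank}M(n-1)$, then there exists a unique representing measure for $\gamma^{(2n)}$, and this measure is $\operatorname{rank}M(n)$-atomic.
   Context: A representing measure for $\gamma^{(2n)}$ is a positive Borel measure $\mu$ on $\mathbb{C}$ such that $\gamma_{ij}=\int\bar z^iz^j\,d\mu(z)$ for $0\le i+j\le 2n$ (these monomials being absolutely integrable); uniqueness is among all such measures. The moment matrix $M(n)(\gamma)$ is the square matrix of size $(n+1)(n+2)/2$ whose rows and columns are labeled by $1,Z,\bar Z,Z^2,\bar ZZ,\bar Z^2,\dots,Z^n,\dots,\bar Z^n$ and whose entry in row $\bar Z^iZ^j$ and column $\bar Z^kZ^l$ ($i+j\le n$, $k+l\le n$) is $\gamma_{k+j,\,l+i}$. $M(n-1)$ is the corresponding matrix of $\{\gamma_{ij}\}_{i+j\le 2n-2}$, i.e., the compression of $M(n)$ to rows and columns of degree at most $n-1$. A measure is $r$-atomic if it is a sum of $r$ positively weighted point masses at distinct points. *)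

theory Defs
  imports "HOL-Probability.Giry_Monad" "Jordan_Normal_Form.DL_Rank" "Jordan_Normal_Form.Conjugate"
begin

text \<open>
  A truncated moment sequence is a function \<open>\<gamma> :: nat \<Rightarrow> nat \<Rightarrow> complex\<close>; everything below
  depends only on the values \<open>\<gamma> i j\<close> with \<open>i + j \<le> 2 * n\<close>. No symmetry
  \<open>\<gamma> j i = cnj (\<gamma> i j)\<close> is presupposed.
\<close>

text \<open>
  The pair \<open>(i, j)\<close> stands for the monomial with exponent \<open>i\<close> of \<open>cnj Z\<close> and exponent \<open>j\<close>
  of \<open>Z\<close>. Monomials are ordered by degree and, within a degree, by increasing exponent of
  \<open>cnj Z\<close>: the list starts with \<open>1, Z, cnj Z, Z^2, cnj Z * Z, (cnj Z)^2\<close>.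
\<close>

definition monomials :: "nat \<Rightarrow> (nat \<times> nat) list" where
  "monomials n = concat (map (\<lambda>d. map (\<lambda>i. (i, d - i)) [0..<Suc d]) [0..<Suc n])"

lemma length_monomials: "length (monomials n) = (n + 1) * (n + 2) div 2"
  by (induction n) (simp_all add: monomials_def)

lemma set_monomials: "set (monomials n) = {(i, j). i + j \<le> n}"
proof -
  have "(i, j) \<in> set (monomials n)" if "i + j \<le> n" for i j
    using that unfolding monomials_def
    by (auto intro!: bexI[of _ "i + j"] image_eqI[of _ _ i] simp del: upt_Suc)
  then show ?thesis
    by (auto simp: monomials_def simp del: upt_Suc)
qed

definition moment_matrix :: "nat \<Rightarrow> (nat \<Rightarrow> nat \<Rightarrow> complex) \<Rightarrow> complex mat" where
  "moment_matrix n \<gamma> = mat (length (monomials n)) (length (monomials n))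
     (\<lambda>(r, c). case (monomials n ! r, monomials n ! c) of
        ((i, j), (k, l)) \<Rightarrow> \<gamma> (k + j) (l + i))"

text \<open>
  The order on \<^typ>\<open>complex\<close> is the one of \<^theory>\<open>HOL-Library.Complex_Order\<close>, so \<open>0 \<le> z\<close>
  says that \<open>z\<close> is real and nonnegative; hence a positive semidefinite matrix is Hermitian.
\<close>

definition pos_semidefinite :: "complex mat \<Rightarrow> bool" where
  "pos_semidefinite A \<longleftrightarrow> dim_row A = dim_col A \<and>
     (\<forall>v \<in> carrier_vec (dim_row A). 0 \<le> (A *\<^sub>v v) \<bullet>c v)"

definition mat_rank :: "complex mat \<Rightarrow> nat" where
  "mat_rank A = vec_space.rank (dim_row A) A"

definition flat :: "nat \<Rightarrow> (nat \<Rightarrow> nat \<Rightarrow> complex) \<Rightarrow> bool" where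
  "flat n \<gamma> \<longleftrightarrow> pos_semidefinite (moment_matrix n \<gamma>) \<and>
     mat_rank (moment_matrix n \<gamma>) = mat_rank (moment_matrix (n - 1) \<gamma>)"

definition representing_measure ::
    "nat \<Rightarrow> (nat \<Rightarrow> nat \<Rightarrow> complex) \<Rightarrow> complex measure \<Rightarrow> bool" where
  "representing_measure n \<gamma> \<mu> \<longleftrightarrow> sets \<mu> = sets borel \<and>
     (\<forall>i j. i + j \<le> 2 * n \<longrightarrow>
        integrable \<mu> (\<lambda>z. cnj z ^ i * z ^ j) \<and>
        \<gamma> i j = (\<integral>z. cnj z ^ i * z ^ j \<partial>\<mu>))"

text \<open>The zero measure is \<open>0\<close>-atomic.\<close>

definition atomic :: "nat \<Rightarrow> complex measure \<Rightarrow> bool" where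
  "atomic r \<mu> \<longleftrightarrow> sets \<mu> = sets borel \<and>
     (\<exists>S (w :: complex \<Rightarrow> real). finite S \<and> card S = r \<and> (\<forall>z\<in>S. 0 < w z) \<and>
        (\<forall>B\<in>sets borel. emeasure \<mu> B = (\<Sum>z\<in>S. ennreal (w z) * emeasure (return borel z) B)))"

end

theory Submission
  imports Defs "HOL-Computational_Algebra.Fundamental_Theorem_Algebra"
    "HOL-Library.Function_Algebras"
begin

text \<open>
  The moment matrix is a semi-inner product on polynomials of degree at most \<open>n\<close>. By flatness
  every such polynomial is equivalent, modulo the kernel, to one of degree at most \<open>n - 1\<close>, so
  multiplication by \<open>z\<close> becomes an operator \<open>T\<close> on the latter, with adjoint multiplication by
  \<open>cnj z\<close>; it is normal because \<open>\<langle>z p, z q\<rangle> = \<langle>cnj z p, cnj z q\<rangle>\<close>. Decompose the constant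
  polynomial as a sum of eigenvectors, \<open>1 = (\<Sum>s\<in>S. e s)\<close>. Then \<open>(\<Sum>s\<in>S. \<parallel>e s\<parallel>\<^sup>2 \<delta>\<^sub>s)\<close> has the
  prescribed moments. Conversely, polynomials in the kernel vanish almost everywhere for any
  representing measure; hence almost everywhere \<open>(z - s) * e s z = 0\<close> and \<open>(\<Sum>s\<in>S. e s z) = 1\<close>, so
  that the measure lives on \<open>S\<close>, \<open>e s\<close> is the indicator of \<open>{s}\<close>, and the mass of \<open>s\<close> is \<open>\<parallel>e s\<parallel>\<^sup>2\<close>.
\<close>

section \<open>Linear systems and column bases\<close>

text \<open>Gaussian elimination by induction on the equations: a pivot unknown \<open>p\<close> of
  equation \<open>i\<close> is eliminated from the others. Exchange arguments, annihilating
  polynomials and the atom count all rest on it.\<close>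

lemma homogeneous_system_nontrivial:
  fixes f :: "'i \<Rightarrow> 'j \<Rightarrow> 'a::field"
  assumes "finite I" "finite J" "card I < card J"
  shows "\<exists>a. (\<exists>j\<in>J. a j \<noteq> 0) \<and> (\<forall>i\<in>I. (\<Sum>j\<in>J. a j * f i j) = 0)"
  using assms
proof (induction I arbitrary: J f rule: finite_induct)
  case empty
  then have "J \<noteq> {}"
    by auto
  then show ?case
    by (intro exI[of _ "\<lambda>_. 1"]) auto
next
  case (insert i I)
  show ?case
  proof (cases "\<forall>j\<in>J. f i j = 0")
    case True
    obtain a where "\<exists>j\<in>J. a j \<noteq> 0" "\<forall>i\<in>I. (\<Sum>j\<in>J. a j * f i j) = 0"
      using insert.IH[of J f] insert.prems insert.hyps by auto
    with True show ?thesis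
      by auto
  next
    case False
    then obtain p where p: "p \<in> J" "f i p \<noteq> 0"
      by blast
    let ?g = "\<lambda>k j. f k j - f i j / f i p * f k p"
    have "card I < card (J - {p})"
      using insert.prems insert.hyps p by simp
    then obtain a where a: "\<exists>j\<in>J - {p}. a j \<noteq> 0"
        "\<And>k. k \<in> I \<Longrightarrow> (\<Sum>j\<in>J - {p}. a j * ?g k j) = 0"
      using insert.IH[of "J - {p}" ?g] insert.prems by auto
    \<comment> \<open>Back-substitution: the value at \<open>p\<close> is the one that solves
      equation \<open>i\<close>. For \<open>k = i\<close> the reduced coefficients
      \<open>?g i j\<close> are all 0, so that equation needs nothing from \<open>a\<close>.\<close>
    define b where "b j = (if j = p then - (\<Sum>j\<in>J - {p}. a j * f i j) / f i p else a j)" for j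
    have b: "(\<Sum>j\<in>J. b j * f k j) = (\<Sum>j\<in>J - {p}. a j * ?g k j)" for k
    proof -
      have "(\<Sum>j\<in>J. b j * f k j) = b p * f k p + (\<Sum>j\<in>J - {p}. b j * f k j)"
        using p insert.prems by (simp add: sum.remove)
      also have "(\<Sum>j\<in>J - {p}. b j * f k j) = (\<Sum>j\<in>J - {p}. a j * f k j)"
        by (rule sum.cong) (auto simp: b_def)
      also have "b p * f k p = - (\<Sum>j\<in>J - {p}. a j * (f i j / f i p * f k p))"
        by (simp add: b_def sum_distrib_left sum_distrib_right sum_divide_distrib mult_ac)
      finally show ?thesis
        by (simp add: right_diff_distrib sum_subtractf)
    qed
    have "\<exists>j\<in>J. b j \<noteq> 0"
      using a(1) by (auto simp: b_def)
    moreover have "(\<Sum>j\<in>J. b j * f k j) = 0" if "k \<in> insert i I" for k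
      using that a(2)[of k] p by (auto simp: b simp del: sum.insert)
    ultimately show ?thesis
      by blast
  qed
qed

text \<open>The rank is the size of a maximal independent set of columns, and maximality makes that
  set spanning; \<open>J\<close> picks one index for each of its columns. Plain sums replace vectors
  so that the columns can later be relabelled by monomials.\<close>

lemma (in vec_space) rank_column_basis:
  assumes A: "A \<in> carrier_mat n nc"
  shows "\<exists>J\<subseteq>{..<nc}. card J = rank A \<and>
    (\<forall>a. (\<forall>i<n. (\<Sum>j\<in>J. a j * A $$ (i, j)) = 0) \<longrightarrow> (\<forall>j\<in>J. a j = 0)) \<and>
    (\<forall>k<nc. \<exists>a. \<forall>i<n. A $$ (i, k) = (\<Sum>j\<in>J. a j * A $$ (i, j)))"
proof -
  have "finite {}" "lin_indpt {}"
    using finite_lin_indpt2 by auto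
  then obtain S where S: "finite S" "maximal S (\<lambda>T. T \<subseteq> set (cols A) \<and> lin_indpt T)"
    using maximal_exists_superset[of "set (cols A)" "\<lambda>T. T \<subseteq> set (cols A) \<and> lin_indpt T" "{}"] by auto
  then have sub: "S \<subseteq> set (cols A)" and indep: "lin_indpt S"
    by (auto simp: maximal_def)
  have carr: "set (cols A) \<subseteq> carrier_vec n"
    using cols_dim A by blast
  have "\<forall>v\<in>S. \<exists>j<nc. col A j = v"
  proof
    fix v assume "v \<in> S"
    then have "v \<in> set (cols A)" using sub by blast
    then show "\<exists>j<nc. col A j = v"
      using A by (auto simp: cols_def)
  qed
  then obtain idx where idx: "\<And>v. v \<in> S \<Longrightarrow> idx v < nc \<and> col A (idx v) = v"
    by metis
  have inj: "inj_on idx S"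
    by (metis idx inj_onI)
  have entry: "A $$ (i, idx v) = v $ i" if "v \<in> S" "i < n" for v i
    using idx[OF that(1)] A that by (metis carrier_matD index_col)
  have lincomb: "lincomb b S $ i = (\<Sum>j\<in>idx ` S. b (col A j) * A $$ (i, j))" if "i < n" for b i
    using that sub carr
    by (subst lincomb_index) (auto simp: sum.reindex[OF inj] entry idx intro!: sum.cong)
  show ?thesis
  proof (intro exI[of _ "idx ` S"] conjI allI impI)
    show "idx ` S \<subseteq> {..<nc}"
      using idx by auto
    show "card (idx ` S) = rank A"
      using rank_card_indpt[OF A S(2)] inj by (simp add: card_image)
  next
    fix a assume 0: "\<forall>i<n. (\<Sum>j\<in>idx ` S. a j * A $$ (i, j)) = 0"
    have "lincomb (a \<circ> idx) S = 0\<^sub>v n"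
    proof (rule eq_vecI)
      fix i assume "i < dim_vec (0\<^sub>v n :: 'a vec)"
      then have i: "i < n" by simp
      have "lincomb (a \<circ> idx) S $ i = (\<Sum>j\<in>idx ` S. a j * A $$ (i, j))"
        unfolding lincomb[OF i] by (rule sum.cong) (auto simp: idx)
      then show "lincomb (a \<circ> idx) S $ i = 0\<^sub>v n $ i"
        using 0 i by simp
    next
      show "dim_vec (lincomb (a \<circ> idx) S) = dim_vec (0\<^sub>v n :: 'a vec)"
        using lincomb_dim[OF S(1), of "a \<circ> idx"] sub carr by auto
    qed
    then show "\<forall>j\<in>idx ` S. a j = 0"
      using lin_dep_crit[OF S(1) subset_refl, of _ "a \<circ> idx"] indep by auto
  next
    fix k assume k: "k < nc"
    have colk: "col A k \<in> set (cols A)"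
      using k A by (metis carrier_matD(2) cols_length cols_nth nth_mem)
    have "col A k \<in> span S"
    proof (cases "col A k \<in> S")
      case True
      then show ?thesis
        using span_mem sub carr by blast
    next
      case False
      show ?thesis
      proof (rule ccontr)
        assume "col A k \<notin> span S"
        then have "lin_indpt (S \<union> {col A k})"
          using lin_dep_iff_in_span[of S "col A k"] sub carr colk indep False by auto
        then have "S \<union> {col A k} = S"
          using S(2) sub colk by (auto simp: maximal_def)
        with False show False
          by auto
      qed
    qed
    then obtain b where b: "col A k = lincomb b S"
      using finite_span[OF S(1)] sub carr by auto
    have "A $$ (i, k) = (\<Sum>j\<in>idx ` S. b (col A j) * A $$ (i, j))" if "i < n" for i
      using lincomb[OF that, of b] A k that b[symmetric] by simp
    then show "\<exists>a. \<forall>i<n. A $$ (i, k) = (\<Sum>j\<in>idx ` S. a j * A $$ (i, j))"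
      by (intro exI[of _ "\<lambda>j. b (col A j)"]) auto
  qed
qed

section \<open>Normal operators on semi-inner product spaces\<close>

text \<open>The form may be degenerate, as the moment matrix has a kernel. No quotient is formed;
  equations between vectors are stated modulo \<open>null\<close> instead.\<close>

locale semi_inner_product = vector_space scale
  for scale :: "complex \<Rightarrow> 'v::ab_group_add \<Rightarrow> 'v" (infixr "*s" 75) +
  fixes ip :: "'v \<Rightarrow> 'v \<Rightarrow> complex"
  assumes ip_add_left: "ip (x + y) z = ip x z + ip y z"
    and ip_scale_left: "ip (c *s x) z = c * ip x z"
    and ip_commute: "ip y x = cnj (ip x y)"
    and ip_nonneg: "0 \<le> Re (ip x x)"
begin

lemma ip_add_right: "ip z (x + y) = ip z x + ip z y"
  by (metis complex_cnj_add ip_add_left ip_commute)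

lemma ip_scale_right: "ip z (c *s x) = cnj c * ip z x"
  by (metis complex_cnj_mult ip_commute ip_scale_left)

lemma ip_zero_left [simp]: "ip 0 z = 0"
  using ip_scale_left[of 0 0 z] by simp

lemma ip_diff_left: "ip (x - y) z = ip x z - ip y z"
  using ip_add_left[of "x - y" y z] by simp

lemma ip_diff_right: "ip z (x - y) = ip z x - ip z y"
  using ip_add_right[of z "x - y" y] by simp

lemma ip_sum_left: "ip (\<Sum>i\<in>A. f i) z = (\<Sum>i\<in>A. ip (f i) z)"
  by (induction A rule: infinite_finite_induct) (simp_all add: ip_add_left)

definition null :: "'v \<Rightarrow> bool" where
  "null x \<longleftrightarrow> (\<forall>z. ip x z = 0)"

text \<open>The degenerate case of Cauchy-Schwarz: if \<open>x\<close> has norm 0 but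
  \<open>ip x y\<close> is nonzero, then the squared norm of \<open>y + a *s x\<close> is affine in
  \<open>a\<close> and becomes negative for a suitable \<open>a\<close>.\<close>

lemma nullI: "null x" if "ip x x = 0"
  unfolding null_def
proof (rule allI, rule ccontr)
  fix y assume y: "ip x y \<noteq> 0"
  define c where "c = (norm (ip x y))\<^sup>2"
  have c: "c > 0"
    using y by (simp add: c_def)
  \<comment> \<open>Chosen so that the squared norm comes out as exactly -1.\<close>
  define t where "t = (Re (ip y y) + 1) / (2 * c)"
  define a where "a = - of_real t * cnj (ip x y)"
  have "ip (y + a *s x) (y + a *s x) = ip y y + (a * ip x y + cnj (a * ip x y))"
    using that ip_commute[of x y]
    by (simp add: ip_add_left ip_add_right ip_scale_left ip_scale_right algebra_simps)
  moreover have "a * ip x y = - of_real (t * c)"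
    using complex_norm_square[of "ip x y"] by (simp add: a_def c_def mult_ac del: of_real_power)
  ultimately have "Re (ip (y + a *s x) (y + a *s x)) = Re (ip y y) - 2 * (t * c)"
    by simp
  also have "\<dots> = -1"
    using c by (simp add: t_def field_simps)
  finally show False
    using ip_nonneg[of "y + a *s x"] by simp
qed

end

section \<open>Eigenvector decomposition for a normal operator\<close>

locale normal_operator = semi_inner_product scale ip
  for scale :: "complex \<Rightarrow> 'v::ab_group_add \<Rightarrow> 'v" (infixr "*s" 75) and ip +
  fixes T Ts :: "'v \<Rightarrow> 'v"
  assumes T_add: "T (x + y) = T x + T y"
    and T_scale: "T (c *s x) = c *s T x"
    and adjoint: "ip (T x) y = ip x (Ts y)"
    and normal: "ip (T x) (T y) = ip (Ts x) (Ts y)"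
begin

lemma adjoint': "ip (Ts x) y = ip x (T y)"
  by (metis adjoint ip_commute)

lemma T_diff: "T (x - y) = T x - T y"
  using T_add[of "x - y" y] by simp

lemma T_pow_diff_scale: "(T ^^ k) (T x - c *s x) = (T ^^ Suc k) x - c *s (T ^^ k) x"
  by (induction k) (simp_all add: T_diff T_scale)

lemma normal_shift:
  "ip (T x - c *s x) (T y - c *s y) = ip (Ts x - cnj c *s x) (Ts y - cnj c *s y)"
proof -
  have "ip x (Ts (T y)) = ip x (T (Ts y))"
    using normal[of x y] by (simp add: adjoint adjoint')
  then show ?thesis
    by (simp add: ip_diff_left ip_diff_right ip_scale_left ip_scale_right adjoint adjoint' algebra_simps)
qed

text \<open>The eigenvalue equation holds only modulo \<open>null\<close>, and null vectors are
  eigenvectors for every \<open>s\<close>; they receive weight 0 later.\<close>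

definition eigenvector :: "complex \<Rightarrow> 'v \<Rightarrow> bool" where
  "eigenvector s x \<longleftrightarrow> null (T x - s *s x)"

lemma ip_T_eigenvector: "eigenvector s x \<Longrightarrow> ip (T x) z = s * ip x z"
  by (simp add: eigenvector_def null_def ip_diff_left ip_scale_left)

text \<open>By \<open>normal_shift\<close>, \<open>Ts x - cnj s *s x\<close> has the same norm as
  \<open>T x - s *s x\<close>, namely 0.\<close>

lemma ip_Ts_eigenvector:
  assumes "eigenvector s x"
  shows "ip (Ts x) z = cnj s * ip x z"
proof -
  have "ip (Ts x - cnj s *s x) (Ts x - cnj s *s x) = 0"
    using assms unfolding normal_shift[symmetric] by (simp add: eigenvector_def null_def)
  then have "ip (Ts x - cnj s *s x) z = 0"
    using nullI by (simp add: null_def)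
  then show ?thesis
    by (simp add: ip_diff_left ip_scale_left)
qed

lemma eigenvectors_orthogonal:
  assumes "eigenvector s x" "eigenvector t y" "s \<noteq> t"
  shows "ip x y = 0"
proof -
  have "s * ip x y = ip x (Ts y)"
    using assms(1) by (simp add: adjoint[symmetric] ip_T_eigenvector)
  also have "\<dots> = t * ip x y"
    using ip_Ts_eigenvector[OF assms(2)] ip_commute by (metis complex_cnj_cnj complex_cnj_mult)
  finally show ?thesis
    using assms(3) by simp
qed

text \<open>A normal operator has no Jordan chains: with \<open>y = T x - c *s x\<close>, the
  adjoint gives \<open>ip y y = ip x (Ts y - cnj c *s y)\<close>, which is 0 because
  \<open>y\<close> is also an eigenvector of \<open>Ts\<close>.\<close>

lemma eigenvector_if_generalized:
  assumes "eigenvector c (T x - c *s x)"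
  shows "eigenvector c x"
proof -
  let ?y = "T x - c *s x"
  have "ip ?y y = ip x (Ts y - cnj c *s y)" for y
    by (simp add: ip_diff_left ip_diff_right ip_scale_left ip_scale_right adjoint)
  then have "ip ?y ?y = ip x (Ts ?y - cnj c *s ?y)" .
  also have "\<dots> = cnj (ip (Ts ?y - cnj c *s ?y) x)"
    by (rule ip_commute)
  also have "\<dots> = 0"
    using ip_Ts_eigenvector[OF assms] by (simp add: ip_diff_left[of "Ts ?y"] ip_scale_left)
  finally show ?thesis
    unfolding eigenvector_def by (rule nullI)
qed

text \<open>Induction on a degree bound for a polynomial that annihilates the single vector
  \<open>x\<close>. Splitting off a root, \<open>p = (X - c) q\<close>, leaves \<open>q\<close>
  annihilating \<open>T x - c *s x\<close>, which the induction hypothesis decomposes; it remains to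
  undo \<open>T - c\<close> on the summands.\<close>

lemma eigenvector_decomposition:
  assumes "p \<noteq> 0" "degree p \<le> N" "null (\<Sum>i\<le>N. coeff p i *s (T ^^ i) x)"
  shows "\<exists>S e. finite S \<and> (\<forall>s\<in>S. eigenvector s (e s)) \<and> null (x - (\<Sum>s\<in>S. e s))"
  using assms
proof (induction N arbitrary: p x)
  case 0
  then have "coeff p 0 \<noteq> 0"
    using leading_coeff_0_iff[of p] by simp
  moreover have "ip (coeff p 0 *s x) z = 0" for z
    using 0(3) by (simp add: null_def)
  ultimately have "null x"
    by (simp add: null_def ip_scale_left)
  then show ?case
    by (intro exI[of _ "{}"]) auto
next
  case (Suc N)
  show ?case
  proof (cases "degree p \<le> N")
    case True
    then have "coeff p (Suc N) = 0"
      by (intro coeff_eq_0) auto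
    then show ?thesis
      using Suc.IH[OF Suc.prems(1) True] Suc.prems(3) by simp
  next
    case False
    then have "\<not> constant (poly p)"
      by (simp add: constant_degree)
    then obtain c where "poly p c = 0"
      using fundamental_theorem_of_algebra by blast
    then obtain q where q: "p = [:- c, 1:] * q"
      by (auto simp: poly_eq_0_iff_dvd elim: dvdE)
    have "q \<noteq> 0"
      using Suc.prems(1) q by auto
    then have deg: "degree q \<le> N"
      using Suc.prems(2) degree_mult_eq[of "[:- c, 1:]" q] by (auto simp: q)
    have coeff_p: "coeff p i = (case i of 0 \<Rightarrow> 0 | Suc k \<Rightarrow> coeff q k) - c * coeff q i" for i
      by (simp add: q coeff_pCons split: nat.split)
    have "(\<Sum>i\<le>Suc N. coeff p i *s (T ^^ i) x) =
        (\<Sum>i\<le>N. coeff q i *s (T ^^ Suc i) x) - (\<Sum>i\<le>Suc N. (c * coeff q i) *s (T ^^ i) x)"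
      by (simp only: coeff_p scale_left_diff_distrib sum_subtractf)
         (simp add: sum.atMost_Suc_shift del: sum.atMost_Suc)
    also have "(\<Sum>i\<le>Suc N. (c * coeff q i) *s (T ^^ i) x) = (\<Sum>i\<le>N. (c * coeff q i) *s (T ^^ i) x)"
      using deg by (simp add: coeff_eq_0)
    also have "(\<Sum>i\<le>N. coeff q i *s (T ^^ Suc i) x) - \<dots> = (\<Sum>i\<le>N. coeff q i *s (T ^^ i) (T x - c *s x))"
      by (simp only: T_pow_diff_scale scale_right_diff_distrib sum_subtractf scale_scale mult.commute[of c])
    finally obtain S e where S: "finite S" and e: "\<And>s. s \<in> S \<Longrightarrow> eigenvector s (e s)"
        and y: "null (T x - c *s x - (\<Sum>s\<in>S. e s))"
      using Suc.IH[OF \<open>q \<noteq> 0\<close> deg, of "T x - c *s x"] Suc.prems(3) by auto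
    \<comment> \<open>On an eigenvector for \<open>s\<close> different from \<open>c\<close>,
      division by \<open>s - c\<close> inverts \<open>T - c\<close>. Subtracting these preimages
      leaves \<open>w\<close>, with \<open>T w - c *s w\<close> equal to the
      \<open>c\<close>-component \<open>ec\<close> modulo \<open>null\<close>; so \<open>w\<close>
      is a generalized eigenvector.\<close>
    define w where "w = x - (\<Sum>s\<in>S - {c}. (1 / (s - c)) *s e s)"
    define ec where "ec = (if c \<in> S then e c else 0)"
    have T_sum: "T (\<Sum>s\<in>A. f s) = (\<Sum>s\<in>A. T (f s))" for A f
      using T_scale[of 0 0] by (induction A rule: infinite_finite_induct) (simp_all add: T_add)
    have "ip (T w - c *s w) z = ip ec z" for z
    proof -
      have "ip (T w - c *s w) z = ip (T x - c *s x) z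
          - (\<Sum>s\<in>S - {c}. 1 / (s - c) * ip (T (e s)) z - c * (1 / (s - c) * ip (e s) z))"
        by (simp add: w_def T_diff T_sum T_scale ip_diff_left ip_scale_left ip_sum_left
            sum_distrib_left sum_subtractf) (simp add: algebra_simps sum_distrib_left)
      also have "(\<Sum>s\<in>S - {c}. 1 / (s - c) * ip (T (e s)) z - c * (1 / (s - c) * ip (e s) z))
          = (\<Sum>s\<in>S - {c}. ip (e s) z)"
      proof (rule sum.cong)
        fix s assume s: "s \<in> S - {c}"
        then have "1 / (s - c) * (s * i) - c * (1 / (s - c) * i) = i" for i
          by (simp add: divide_simps) (simp add: algebra_simps)
        then show "1 / (s - c) * ip (T (e s)) z - c * (1 / (s - c) * ip (e s) z) = ip (e s) z"
          using s by (simp add: ip_T_eigenvector[OF e])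
      qed simp
      also have "ip (T x - c *s x) z = (\<Sum>s\<in>S. ip (e s) z)"
        using y by (simp add: null_def ip_diff_left ip_sum_left)
      also have "\<dots> = ip ec z + (\<Sum>s\<in>S - {c}. ip (e s) z)"
        using S by (auto simp: ec_def sum.remove)
      finally show ?thesis
        by simp
    qed
    moreover have "eigenvector c ec"
      using e T_scale[of 0 0] by (auto simp: ec_def eigenvector_def null_def)
    ultimately have "ip (T (T w - c *s w) - c *s (T w - c *s w)) z = 0" for z
      using ip_T_eigenvector[of c ec z]
      by (simp only: ip_diff_left[of "T (T w - c *s w)"] ip_scale_left adjoint diff_self)
    then have "eigenvector c (T w - c *s w)"
      by (simp add: eigenvector_def null_def)
    then have w: "eigenvector c w"
      by (rule eigenvector_if_generalized)
    define e' where "e' s = (if s = c then w else (1 / (s - c)) *s e s)" for s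
    have "eigenvector s (e' s)" if "s \<in> insert c S" for s
      using that w e[of s] ip_T_eigenvector[of s "e s"]
      by (auto simp: e'_def eigenvector_def null_def T_scale ip_diff_left ip_scale_left)
    moreover have "x - (\<Sum>s\<in>insert c S. e' s) = 0"
    proof -
      have "(\<Sum>s\<in>insert c S. e' s) = e' c + (\<Sum>s\<in>S - {c}. e' s)"
        using S by (rule sum.insert_remove)
      also have "(\<Sum>s\<in>S - {c}. e' s) = (\<Sum>s\<in>S - {c}. (1 / (s - c)) *s e s)"
        by (rule sum.cong) (auto simp: e'_def)
      finally show ?thesis
        by (simp add: e'_def w_def)
    qed
    ultimately show ?thesis
      using S by (intro exI[of _ "insert c S"] exI[of _ e']) (auto simp: null_def)
  qed
qed

end

section \<open>Moment matrices\<close>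

definition deg_le :: "nat \<Rightarrow> (nat \<times> nat) set" where
  "deg_le n = {(i, j). i + j \<le> n}"

lemma finite_deg_le [simp]: "finite (deg_le n)"
  by (rule finite_subset[of _ "{..n} \<times> {..n}"]) (auto simp: deg_le_def)

lemma deg_le_mono: "m \<le> n \<Longrightarrow> deg_le m \<subseteq> deg_le n"
  by (auto simp: deg_le_def)

text \<open>The first argument of \<open>gram\<close> is the column label, the second one the row label.\<close>

definition gram :: "(nat \<Rightarrow> nat \<Rightarrow> complex) \<Rightarrow> nat \<times> nat \<Rightarrow> nat \<times> nat \<Rightarrow> complex" where
  "gram \<gamma> m m' = \<gamma> (fst m + snd m') (snd m + fst m')"

lemma distinct_monomials: "distinct (monomials n)"
proof (induction n)
  case 0
  then show ?case
    by (simp add: monomials_def)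
next
  case (Suc n)
  have "monomials (Suc n) = monomials n @ map (\<lambda>i. (i, Suc n - i)) [0..<Suc (Suc n)]"
    by (simp add: monomials_def)
  then show ?case
    using Suc by (auto simp: set_monomials distinct_map inj_on_def simp del: upt_Suc)
qed

lemma bij_betw_monomials: "bij_betw ((!) (monomials n)) {..<length (monomials n)} (deg_le n)"
  using bij_betw_nth[OF distinct_monomials refl set_monomials[unfolded deg_le_def[symmetric], symmetric]] .

lemma moment_matrix_index:
  "r < length (monomials n) \<Longrightarrow> s < length (monomials n) \<Longrightarrow>
    moment_matrix n \<gamma> $$ (r, s) = gram \<gamma> (monomials n ! s) (monomials n ! r)"
  by (simp add: moment_matrix_def gram_def split: prod.split)

text \<open>Labels replace positions: \<open>gram\<close> does not mention \<open>n\<close>, so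
  \<open>moment_matrix k\<close> for smaller \<open>k\<close> is the restriction of the same
  function to \<open>deg_le k\<close>.\<close>

lemma moment_matrix_column_basis:
  "\<exists>J\<subseteq>deg_le n. card J = mat_rank (moment_matrix n \<gamma>) \<and>
    (\<forall>a. (\<forall>m'\<in>deg_le n. (\<Sum>m\<in>J. a m * gram \<gamma> m m') = 0) \<longrightarrow> (\<forall>m\<in>J. a m = 0)) \<and>
    (\<forall>m\<in>deg_le n. \<exists>a. \<forall>m'\<in>deg_le n. gram \<gamma> m m' = (\<Sum>j\<in>J. a j * gram \<gamma> j m'))"
proof -
  let ?N = "length (monomials n)" and ?x = "(!) (monomials n)" and ?M = "moment_matrix n \<gamma>"
  have "?M \<in> carrier_mat ?N ?N"
    by (simp add: moment_matrix_def)
  from vec_space.rank_column_basis[OF this]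
  obtain J where J: "J \<subseteq> {..<?N}" "card J = mat_rank ?M"
    and indep: "\<And>a. (\<forall>i<?N. (\<Sum>j\<in>J. a j * ?M $$ (i, j)) = 0) \<Longrightarrow> \<forall>j\<in>J. a j = 0"
    and span: "\<And>k. k < ?N \<Longrightarrow> \<exists>a. \<forall>i<?N. ?M $$ (i, k) = (\<Sum>j\<in>J. a j * ?M $$ (i, j))"
    unfolding mat_rank_def by (auto simp: moment_matrix_def)
  have img: "?x ` {..<?N} = deg_le n" and inj: "inj_on ?x {..<?N}"
    using bij_betw_monomials by (auto simp: bij_betw_def)
  have injJ: "inj_on ?x J"
    using inj J(1) by (rule inj_on_subset)
  have sumJ: "(\<Sum>j\<in>J. a j * ?M $$ (i, j)) =
      (\<Sum>m\<in>?x ` J. a (the_inv_into J ?x m) * gram \<gamma> m (?x i))" if "i < ?N" for a i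
    using that J(1)
    by (auto simp: sum.reindex[OF injJ] the_inv_into_f_f[OF injJ] moment_matrix_index subset_iff
        intro!: sum.cong)
  have sumJ': "(\<Sum>m\<in>?x ` J. a m * gram \<gamma> m (?x i)) = (\<Sum>j\<in>J. a (?x j) * ?M $$ (i, j))"
    if "i < ?N" for a i
    using that J(1) by (auto simp: sum.reindex[OF injJ] moment_matrix_index subset_iff intro!: sum.cong)
  show ?thesis
  proof (intro exI[of _ "?x ` J"] conjI allI impI ballI)
    show "?x ` J \<subseteq> deg_le n"
      using J(1) img by auto
    show "card (?x ` J) = mat_rank ?M"
      using J(2) injJ by (simp add: card_image)
  next
    fix a m assume 0: "\<forall>m'\<in>deg_le n. (\<Sum>m\<in>?x ` J. a m * gram \<gamma> m m') = 0" and m: "m \<in> ?x ` J"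
    have "(\<Sum>j\<in>J. a (?x j) * ?M $$ (i, j)) = 0" if "i < ?N" for i
      using 0 img that by (auto simp flip: sumJ')
    then show "a m = 0"
      using indep[of "\<lambda>j. a (?x j)"] m by auto
  next
    fix m assume "m \<in> deg_le n"
    then obtain k where k: "k < ?N" "m = ?x k"
      using img by blast
    from span[OF k(1)] obtain a where a: "\<And>i. i < ?N \<Longrightarrow> ?M $$ (i, k) = (\<Sum>j\<in>J. a j * ?M $$ (i, j))"
      by blast
    show "\<exists>a. \<forall>m'\<in>deg_le n. gram \<gamma> m m' = (\<Sum>j\<in>?x ` J. a j * gram \<gamma> j m')"
    proof (intro exI ballI)
      fix m' assume "m' \<in> deg_le n"
      then obtain i where i: "i < ?N" "m' = ?x i"
        using img by blast
      show "gram \<gamma> m m' = (\<Sum>j\<in>?x ` J. a (the_inv_into J ?x j) * gram \<gamma> j m')"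
        using a[OF i(1)] i k by (simp add: sumJ moment_matrix_index)
    qed
  qed
qed

text \<open>If the rank does not grow, a column basis of the smaller matrix stays a column basis.\<close>

lemma column_reduction:
  assumes "k \<le> n" and "mat_rank (moment_matrix n \<gamma>) = mat_rank (moment_matrix k \<gamma>)"
    and m: "m \<in> deg_le n"
  shows "\<exists>c. \<forall>m'\<in>deg_le n. gram \<gamma> m m' = (\<Sum>b\<in>deg_le k. c b * gram \<gamma> b m')"
proof -
  obtain J where J: "J \<subseteq> deg_le k" "card J = mat_rank (moment_matrix k \<gamma>)"
    and indep: "\<And>a. (\<forall>m'\<in>deg_le k. (\<Sum>m\<in>J. a m * gram \<gamma> m m') = 0) \<Longrightarrow> \<forall>m\<in>J. a m = 0"
    using moment_matrix_column_basis[of k \<gamma>] by auto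
  obtain L where L: "L \<subseteq> deg_le n" "card L = mat_rank (moment_matrix n \<gamma>)"
    and span: "\<forall>m\<in>deg_le n. \<exists>a. \<forall>m'\<in>deg_le n. gram \<gamma> m m' = (\<Sum>j\<in>L. a j * gram \<gamma> j m')"
    using moment_matrix_column_basis[of n \<gamma>] by auto
  from span obtain \<alpha> where
    \<alpha>: "\<And>m m'. m \<in> deg_le n \<Longrightarrow> m' \<in> deg_le n \<Longrightarrow> gram \<gamma> m m' = (\<Sum>j\<in>L. \<alpha> m j * gram \<gamma> j m')"
    by metis
  have sub: "deg_le k \<subseteq> deg_le n"
    using assms(1) by (rule deg_le_mono)
  have finJ: "finite J"
    using J(1) finite_deg_le finite_subset by blast
  have "\<exists>c. \<forall>m'\<in>deg_le n. gram \<gamma> m m' = (\<Sum>b\<in>J. c b * gram \<gamma> b m')"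
  proof (cases "m \<in> J")
    case True
    then show ?thesis
      using finJ by (intro exI[of _ "\<lambda>b. if b = m then 1 else 0"]) (simp add: if_distrib if_distribR cong: if_cong)
  next
    case False
    \<comment> \<open>By equality of ranks \<open>L\<close> has as many elements as
      \<open>J\<close>, so the columns in \<open>insert m J\<close> are too many to be
      independent.\<close>
    have "finite L" "card L < card (insert m J)"
      using L J assms(2) False finJ finite_subset[OF L(1)] by auto
    then obtain a where a: "\<exists>j\<in>insert m J. a j \<noteq> 0"
        "\<And>i. i \<in> L \<Longrightarrow> (\<Sum>j\<in>insert m J. a j * \<alpha> j i) = 0"
      using homogeneous_system_nontrivial[of L "insert m J" "\<lambda>i j. \<alpha> j i"] finJ by auto
    have dep: "a m * gram \<gamma> m m' + (\<Sum>j\<in>J. a j * gram \<gamma> j m') = 0" if "m' \<in> deg_le n" for m'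
    proof -
      have "(\<Sum>j\<in>insert m J. a j * gram \<gamma> j m') = (\<Sum>j\<in>insert m J. \<Sum>i\<in>L. a j * \<alpha> j i * gram \<gamma> i m')"
        using m J(1) sub that by (intro sum.cong) (auto simp: \<alpha>[of _ m'] sum_distrib_left mult.assoc)
      also have "\<dots> = (\<Sum>i\<in>L. (\<Sum>j\<in>insert m J. a j * \<alpha> j i) * gram \<gamma> i m')"
        by (subst sum.swap) (simp only: sum_distrib_right)
      also have "\<dots> = 0"
        using a(2) by simp
      finally show ?thesis
        using finJ False by simp
    qed
    \<comment> \<open>Otherwise the dependence would involve only \<open>J\<close>, whose columns
      are independent already on the rows of degree at most \<open>k\<close>.\<close>
    have "a m \<noteq> 0"
    proof
      assume "a m = 0"
      then have "\<forall>m'\<in>deg_le k. (\<Sum>j\<in>J. a j * gram \<gamma> j m') = 0"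
        using dep sub by auto
      with indep a(1) \<open>a m = 0\<close> show False
        by blast
    qed
    have "gram \<gamma> m m' = (\<Sum>j\<in>J. - a j / a m * gram \<gamma> j m')" if "m' \<in> deg_le n" for m'
    proof -
      have "gram \<gamma> m m' = - (\<Sum>j\<in>J. a j * gram \<gamma> j m') / a m"
        using dep[OF that] \<open>a m \<noteq> 0\<close> by (simp add: field_simps eq_neg_iff_add_eq_0)
      then show ?thesis
        by (simp add: sum_divide_distrib sum_negf)
    qed
    then show ?thesis
      by (intro exI[of _ "\<lambda>j. - a j / a m"]) blast
  qed
  then obtain c where c: "\<And>m'. m' \<in> deg_le n \<Longrightarrow> gram \<gamma> m m' = (\<Sum>b\<in>J. c b * gram \<gamma> b m')"
    by blast
  have "gram \<gamma> m m' = (\<Sum>b\<in>deg_le k. (if b \<in> J then c b else 0) * gram \<gamma> b m')"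
    if "m' \<in> deg_le n" for m'
    unfolding c[OF that] using J(1) by (intro sum.mono_neutral_cong_left) auto
  then show ?thesis
    by (intro exI[of _ "\<lambda>b. if b \<in> J then c b else 0"]) blast
qed

lemma pos_semidefinite_gram:
  assumes "pos_semidefinite (moment_matrix n \<gamma>)"
  shows "0 \<le> (\<Sum>m\<in>deg_le n. \<Sum>m'\<in>deg_le n. f m * cnj (f m') * gram \<gamma> m m')"
proof -
  let ?N = "length (monomials n)" and ?x = "(!) (monomials n)" and ?M = "moment_matrix n \<gamma>"
  define v where "v = vec ?N (\<lambda>i. f (?x i))"
  have M: "?M \<in> carrier_mat ?N ?N"
    by (simp add: moment_matrix_def)
  have "(?M *\<^sub>v v) \<bullet>c v = (\<Sum>i<?N. (\<Sum>j<?N. ?M $$ (i, j) * f (?x j)) * cnj (f (?x i)))"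
    using M by (simp add: scalar_prod_def v_def atLeast0LessThan)
  also have "\<dots> = (\<Sum>i<?N. \<Sum>j<?N. f (?x j) * cnj (f (?x i)) * gram \<gamma> (?x j) (?x i))"
    by (simp add: moment_matrix_index sum_distrib_left sum_distrib_right mult_ac)
  also have "\<dots> = (\<Sum>m'\<in>deg_le n. \<Sum>m\<in>deg_le n. f m * cnj (f m') * gram \<gamma> m m')"
    by (simp add: sum.reindex_bij_betw[OF bij_betw_monomials, of "\<lambda>m'. \<Sum>m\<in>deg_le n. f m * cnj (f m') * gram \<gamma> m m'"]
       sum.reindex_bij_betw[OF bij_betw_monomials, of "\<lambda>m. f m * cnj (f m') * gram \<gamma> m m'" for m'])
  also have "\<dots> = (\<Sum>m\<in>deg_le n. \<Sum>m'\<in>deg_le n. f m * cnj (f m') * gram \<gamma> m m')"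
    by (rule sum.swap)
  finally have "(?M *\<^sub>v v) \<bullet>c v = (\<Sum>m\<in>deg_le n. \<Sum>m'\<in>deg_le n. f m * cnj (f m') * gram \<gamma> m m')" .
  moreover have "0 \<le> (?M *\<^sub>v v) \<bullet>c v"
    using assms M by (auto simp: pos_semidefinite_def v_def)
  ultimately show ?thesis
    by simp
qed

text \<open>Polarization: unit vectors give real diagonal entries, and vectors with entries 1 and
  \<open>c\<close> at \<open>a\<close> and \<open>b\<close> give the imaginary part of the claim for
  \<open>c = 1\<close> and the real part for \<open>c = \<i>\<close>. This recovers the symmetry
  that \<open>\<gamma>\<close> is not assumed to have.\<close>

lemma hermitian_if_form_real:
  fixes g :: "'i \<Rightarrow> 'i \<Rightarrow> complex"
  assumes "finite K" and real: "\<And>f. Im (\<Sum>a\<in>K. \<Sum>b\<in>K. f a * cnj (f b) * g a b) = 0"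
    and ab: "a \<in> K" "b \<in> K"
  shows "g b a = cnj (g a b)"
proof -
  have supp: "(\<Sum>x\<in>K. \<Sum>y\<in>K. f x * cnj (f y) * g x y) = (\<Sum>x\<in>A. \<Sum>y\<in>A. f x * cnj (f y) * g x y)"
    if "A \<subseteq> K" "\<And>x. x \<notin> A \<Longrightarrow> f x = 0" for f A
    using that assms(1)
    by (intro sum.mono_neutral_cong_right) (auto intro!: sum.mono_neutral_cong_right)
  have diag: "Im (g x x) = 0" if "x \<in> K" for x
    using real[of "\<lambda>y. if y = x then 1 else 0"] that
    by (subst (asm) supp[of "{x}"]) auto
  show ?thesis
  proof (cases "a = b")
    case True
    then show ?thesis
      using diag[OF ab(1)] by (simp add: complex_eq_iff)
  next
    case False
    let ?f = "\<lambda>c x. if x = a then 1 else if x = b then c else 0 :: complex"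
    have form: "Im (g a a + cnj c * g a b + (c * g b a + c * cnj c * g b b)) = 0" for c
      using real[of "?f c"] ab False by (subst (asm) supp[of "{a, b}"]) auto
    show ?thesis
      using form[of 1] form[of \<i>] diag ab by (auto simp: complex_eq_iff)
  qed
qed

section \<open>Multiplication by z on polynomials modulo the kernel\<close>

definition monom_at :: "complex \<Rightarrow> nat \<times> nat \<Rightarrow> complex" where
  "monom_at z m = cnj z ^ fst m * z ^ snd m"

abbreviation (input) Z_times :: "nat \<times> nat \<Rightarrow> nat \<times> nat" where
  "Z_times m \<equiv> (fst m, Suc (snd m))"

abbreviation (input) Zbar_times :: "nat \<times> nat \<Rightarrow> nat \<times> nat" where
  "Zbar_times m \<equiv> (Suc (fst m), snd m)"

text \<open>
  The vectors are coefficient functions of polynomials, of which only the coefficients of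
  degree at most \<open>k\<close> matter; \<open>c m\<close> is a polynomial of degree at most \<open>k\<close> that agrees with the
  monomial \<open>m\<close> of degree at most \<open>k + 1\<close> modulo the kernel of the moment matrix.
\<close>

locale flat_moments =
  fixes k :: nat and \<gamma> :: "nat \<Rightarrow> nat \<Rightarrow> complex" and c :: "nat \<times> nat \<Rightarrow> nat \<times> nat \<Rightarrow> complex"
  assumes form_nonneg:
      "0 \<le> (\<Sum>m\<in>deg_le (Suc k). \<Sum>m'\<in>deg_le (Suc k). f m * cnj (f m') * gram \<gamma> m m')"
    and reduce: "m \<in> deg_le (Suc k) \<Longrightarrow> m' \<in> deg_le (Suc k) \<Longrightarrow>
      gram \<gamma> m m' = (\<Sum>b\<in>deg_le k. c m b * gram \<gamma> b m')"
begin

lemma cnj_gram: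
  "m \<in> deg_le (Suc k) \<Longrightarrow> m' \<in> deg_le (Suc k) \<Longrightarrow> cnj (gram \<gamma> m m') = gram \<gamma> m' m"
  using hermitian_if_form_real[of "deg_le (Suc k)" "gram \<gamma>" m m'] form_nonneg
  by (auto simp: less_eq_complex_def)

lemma deg_le_SucI [simp]: "m \<in> deg_le k \<Longrightarrow> m \<in> deg_le (Suc k)"
  by (auto simp: deg_le_def)

lemma Z_times_deg [simp]: "m \<in> deg_le k \<Longrightarrow> Z_times m \<in> deg_le (Suc k)"
  and Zbar_times_deg [simp]: "m \<in> deg_le k \<Longrightarrow> Zbar_times m \<in> deg_le (Suc k)"
  by (auto simp: deg_le_def)

definition ip :: "(nat \<times> nat \<Rightarrow> complex) \<Rightarrow> (nat \<times> nat \<Rightarrow> complex) \<Rightarrow> complex" where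
  "ip p q = (\<Sum>a\<in>deg_le k. \<Sum>b\<in>deg_le k. p a * cnj (q b) * gram \<gamma> a b)"

text \<open>Multiplication by \<open>z\<close> and by \<open>cnj z\<close>, followed by reduction to degree at most \<open>k\<close>.\<close>

definition T :: "(nat \<times> nat \<Rightarrow> complex) \<Rightarrow> nat \<times> nat \<Rightarrow> complex" where
  "T p = (\<lambda>x. \<Sum>a\<in>deg_le k. p a * c (Z_times a) x)"

definition Ts :: "(nat \<times> nat \<Rightarrow> complex) \<Rightarrow> nat \<times> nat \<Rightarrow> complex" where
  "Ts p = (\<lambda>x. \<Sum>a\<in>deg_le k. p a * c (Zbar_times a) x)"

lemma ip_hermitian: "ip q p = cnj (ip p q)"
proof -
  have "ip q p = (\<Sum>b\<in>deg_le k. \<Sum>a\<in>deg_le k. q a * cnj (p b) * gram \<gamma> a b)"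
    unfolding ip_def by (rule sum.swap)
  also have "\<dots> = cnj (ip p q)"
    unfolding ip_def cnj_sum
    by (intro sum.cong refl) (simp add: cnj_gram mult_ac)
  finally show ?thesis .
qed

lemma ip_self_nonneg: "0 \<le> Re (ip p p)"
proof -
  let ?f = "\<lambda>m. if m \<in> deg_le k then p m else 0"
  have "ip p p = (\<Sum>m\<in>deg_le (Suc k). \<Sum>m'\<in>deg_le (Suc k). ?f m * cnj (?f m') * gram \<gamma> m m')"
    unfolding ip_def
    by (intro sum.mono_neutral_cong_left) (auto intro!: sum.mono_neutral_cong_left)
  then show ?thesis
    using form_nonneg[of ?f] by (simp add: less_eq_complex_def)
qed

text \<open>By \<open>reduce\<close>, the column of \<open>m\<close> is the combination
  \<open>c m\<close> of columns of degree at most \<open>k\<close>. Hence \<open>c m\<close> pairs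
  as the monomial \<open>m\<close> itself would, even in degree \<open>k + 1\<close>.\<close>

lemma ip_c:
  assumes "m \<in> deg_le (Suc k)"
  shows "ip (c m) q = (\<Sum>b\<in>deg_le k. cnj (q b) * gram \<gamma> m b)"
  unfolding ip_def using assms
  by (subst sum.swap) (auto intro!: sum.cong simp: reduce[of m] sum_distrib_left mult_ac)

lemma ip_c_c:
  assumes "m \<in> deg_le (Suc k)" "m' \<in> deg_le (Suc k)"
  shows "ip (c m) (c m') = gram \<gamma> m m'"
proof -
  have "ip (c m) (c m') = cnj (\<Sum>b\<in>deg_le k. c m' b * gram \<gamma> b m)"
    unfolding ip_c[OF assms(1)] cnj_sum
    by (intro sum.cong refl) (simp add: assms cnj_gram)
  then show ?thesis
    using assms by (simp add: reduce[symmetric] cnj_gram)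
qed

lemma ip_expand: "ip p q = (\<Sum>a\<in>deg_le k. p a * ip (c a) q)"
  unfolding ip_def[of p q] by (intro sum.cong refl) (simp add: ip_c sum_distrib_left mult_ac)

lemma ip_lincomb_left: "ip (\<lambda>x. \<Sum>a\<in>A. p a * f a x) q = (\<Sum>a\<in>A. p a * ip (f a) q)"
proof -
  have "ip (\<lambda>x. \<Sum>a\<in>A. p a * f a x) q =
      (\<Sum>b\<in>deg_le k. \<Sum>a\<in>A. p a * (f a b * ip (c b) q))"
    by (simp add: ip_expand[of "\<lambda>x. \<Sum>a\<in>A. p a * f a x"] sum_distrib_right mult.assoc)
  also have "\<dots> = (\<Sum>a\<in>A. p a * (\<Sum>b\<in>deg_le k. f a b * ip (c b) q))"
    by (subst sum.swap) (simp add: sum_distrib_left)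
  finally show ?thesis
    by (simp add: ip_expand[of "f _"])
qed

lemma ip_lincomb_right: "ip p (\<lambda>x. \<Sum>a\<in>A. q a * f a x) = (\<Sum>a\<in>A. cnj (q a) * ip p (f a))"
  unfolding ip_hermitian[of p "\<lambda>x. \<Sum>a\<in>A. q a * f a x"] ip_hermitian[of p "f _"] ip_lincomb_left
  by simp

text \<open>For adjointness, a factor z in one argument of \<open>gram\<close> can be moved to the
  other as its conjugate. For normality, a factor z in both arguments and a factor
  \<open>cnj z\<close> in both arguments raise the two indices of \<open>\<gamma>\<close> by one
  alike.\<close>

sublocale normal_operator "\<lambda>a p x. a * p x" ip T Ts
proof
  fix p q :: "nat \<times> nat \<Rightarrow> complex"
  have T_ip: "ip (T p) q = (\<Sum>a\<in>deg_le k. \<Sum>b\<in>deg_le k. p a * cnj (q b) * gram \<gamma> (Z_times a) b)"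
    unfolding T_def ip_lincomb_left
    by (intro sum.cong refl) (simp add: ip_c sum_distrib_left mult_ac)
  have "cnj (ip (Ts q) p) = (\<Sum>b\<in>deg_le k. \<Sum>a\<in>deg_le k. cnj (q b) * p a * cnj (gram \<gamma> (Zbar_times b) a))"
    unfolding Ts_def ip_lincomb_left cnj_sum
    by (intro sum.cong refl) (simp add: ip_c sum_distrib_left mult_ac)
  also have "\<dots> = (\<Sum>b\<in>deg_le k. \<Sum>a\<in>deg_le k. p a * cnj (q b) * gram \<gamma> (Z_times a) b)"
    by (intro sum.cong refl)
       (simp add: cnj_gram, simp add: gram_def mult_ac)
  finally show "ip (T p) q = ip p (Ts q)"
    unfolding T_ip ip_hermitian[of p "Ts q"] by (subst sum.swap) simp
  show "ip (T p) (T q) = ip (Ts p) (Ts q)"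
    unfolding T_def Ts_def ip_lincomb_left ip_lincomb_right
    by (intro sum.cong refl) (simp add: ip_c_c gram_def)
  show "ip q p = cnj (ip p q)"
    by (rule ip_hermitian)
  show "0 \<le> Re (ip p p)"
    by (rule ip_self_nonneg)
qed (auto simp: fun_eq_iff algebra_simps T_def ip_def sum.distrib sum_distrib_left)

lemma null_if_vanishing: "(\<And>a. a \<in> deg_le k \<Longrightarrow> p a = 0) \<Longrightarrow> null p"
  by (simp add: null_def ip_expand[of p])

lemma ip_c_unit: "a \<in> deg_le k \<Longrightarrow> ip (c a) q = ip (\<lambda>x. if x = a then 1 else 0) q"
  by (simp add: ip_expand[of "\<lambda>x. if x = a then 1 else 0"] if_distrib if_distribR cong: if_cong)

text \<open>The vector \<open>c m\<close> and the unit vector at \<open>m\<close> agree only modulo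
  \<open>null\<close> (\<open>ip_c_unit\<close>); \<open>T\<close> respects this because it has an
  adjoint.\<close>

lemma ip_T_c:
  assumes "m \<in> deg_le k"
  shows "ip (T (c m)) z = ip (c (Z_times m)) z"
proof -
  have "ip (T (c m)) z = ip (T (\<lambda>x. if x = m then 1 else 0)) z"
    using assms by (simp add: adjoint ip_c_unit)
  then show ?thesis
    using assms by (simp add: T_def if_distrib if_distribR cong: if_cong)
qed

lemma ip_Ts_c:
  assumes "m \<in> deg_le k"
  shows "ip (Ts (c m)) z = ip (c (Zbar_times m)) z"
proof -
  have "ip (Ts (c m)) z = ip (Ts (\<lambda>x. if x = m then 1 else 0)) z"
    using assms by (simp add: adjoint' ip_c_unit)
  then show ?thesis
    using assms by (simp add: Ts_def if_distrib if_distribR cong: if_cong)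
qed

text \<open>Only the \<open>?N\<close> coefficients in \<open>deg_le k\<close> matter modulo
  \<open>null\<close>, so the \<open>?N + 1\<close> vectors \<open>(T ^^ j) x\<close> are dependent
  there, which yields an annihilating polynomial.\<close>

lemma ex_eigenvector_decomposition:
  "\<exists>S e. finite S \<and> (\<forall>s\<in>S. eigenvector s (e s)) \<and> null (x - (\<Sum>s\<in>S. e s))"
proof -
  let ?N = "card (deg_le k)"
  have "card (deg_le k) < card {..?N}"
    by simp
  then obtain a where a: "\<exists>j\<in>{..?N}. a j \<noteq> 0"
      "\<And>i. i \<in> deg_le k \<Longrightarrow> (\<Sum>j\<le>?N. a j * (T ^^ j) x i) = 0"
    using homogeneous_system_nontrivial[of "deg_le k" "{..?N}" "\<lambda>i j. (T ^^ j) x i"] by auto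
  define p where "p = (\<Sum>j\<le>?N. monom (a j) j)"
  have coeff_p: "coeff p j = (if j \<le> ?N then a j else 0)" for j
    by (simp add: p_def coeff_sum)
  have "p \<noteq> 0"
    using a(1) coeff_p by (metis atMost_iff coeff_0)
  moreover have "degree p \<le> ?N"
    by (rule degree_le) (simp add: coeff_p)
  moreover have "null (\<Sum>j\<le>?N. (\<lambda>i. coeff p j * (T ^^ j) x i))"
  proof (rule null_if_vanishing)
    have sum_apply: "(\<Sum>j\<in>A. f j) i = (\<Sum>j\<in>A. f j i)" for A and f :: "nat \<Rightarrow> nat \<times> nat \<Rightarrow> complex" and i
      by (induction A rule: infinite_finite_induct) auto
    show "(\<Sum>j\<le>?N. (\<lambda>i. coeff p j * (T ^^ j) x i)) i = 0" if "i \<in> deg_le k" for i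
      using a(2)[OF that] by (simp add: sum_apply coeff_p)
  qed
  ultimately show ?thesis
    by (rule eigenvector_decomposition)
qed

end

section \<open>Spectral expansion of the moments and the number of atoms\<close>

locale flat_spectrum = flat_moments +
  fixes S :: "complex set" and e :: "complex \<Rightarrow> nat \<times> nat \<Rightarrow> complex"
  assumes finite_S [simp]: "finite S"
    and eigen: "s \<in> S \<Longrightarrow> eigenvector s (e s)"
    and decomp: "null (c (0, 0) - (\<Sum>s\<in>S. e s))"
begin

text \<open>The monomial \<open>m\<close> acts on the component \<open>e s\<close> of 1 as the
  scalar \<open>monom_at s m\<close>. The induction peels off one factor and moves it to
  \<open>z\<close> by adjointness, so \<open>z\<close> must be arbitrary.\<close>

lemma ip_c_spectral:
  "m \<in> deg_le (Suc k) \<Longrightarrow> ip (c m) z = (\<Sum>s\<in>S. monom_at s m * ip (e s) z)"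
proof (induction "fst m + snd m" arbitrary: m z)
  case 0
  then show ?case
    using decomp by (cases m) (simp add: null_def ip_diff_left ip_sum_left monom_at_def)
next
  case (Suc d)
  show ?case
  proof (cases "snd m")
    case 0
    then obtain i where m: "m = Zbar_times (i, 0)"
      using Suc.hyps(2) by (cases m) auto
    then have i: "(i, 0) \<in> deg_le k"
      using Suc.prems by (auto simp: deg_le_def)
    have "ip (c m) z = ip (c (i, 0)) (T z)"
      using ip_Ts_c[OF i] by (simp add: m adjoint')
    also have "\<dots> = (\<Sum>s\<in>S. monom_at s (i, 0) * ip (Ts (e s)) z)"
      using Suc.hyps m i by (simp add: adjoint')
    also have "\<dots> = (\<Sum>s\<in>S. monom_at s m * ip (e s) z)"
      by (intro sum.cong refl) (simp add: ip_Ts_eigenvector eigen m monom_at_def)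
    finally show ?thesis .
  next
    case (Suc j)
    then obtain i where m: "m = Z_times (i, j)"
      by (cases m) auto
    then have i: "(i, j) \<in> deg_le k"
      using Suc.prems by (auto simp: deg_le_def)
    have "ip (c m) z = ip (c (i, j)) (Ts z)"
      using ip_T_c[OF i] by (simp add: m adjoint)
    also have "\<dots> = (\<Sum>s\<in>S. monom_at s (i, j) * ip (T (e s)) z)"
      using Suc.hyps(1)[of "(i, j)"] \<open>Suc d = fst m + snd m\<close> m i by (simp add: adjoint)
    also have "\<dots> = (\<Sum>s\<in>S. monom_at s m * ip (e s) z)"
      by (intro sum.cong refl) (simp add: ip_T_eigenvector eigen m monom_at_def)
    finally show ?thesis .
  qed
qed

definition weight :: "complex \<Rightarrow> real" where
  "weight s = Re (ip (e s) (e s))"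

lemma ip_e: "s \<in> S \<Longrightarrow> t \<in> S \<Longrightarrow> ip (e s) (e t) = (if s = t then of_real (weight s) else 0)"
  using eigenvectors_orthogonal[OF eigen eigen, of s t] arg_cong[OF ip_hermitian[of "e s" "e s"], of Im]
  by (cases "s = t") (auto simp: weight_def intro: complex_eqI)

lemma weight_nonneg: "0 \<le> weight s"
  by (simp add: weight_def ip_nonneg)

lemma ip_c_e: "m \<in> deg_le (Suc k) \<Longrightarrow> t \<in> S \<Longrightarrow> ip (c m) (e t) = monom_at t m * of_real (weight t)"
  by (simp add: ip_c_spectral ip_e if_distrib cong: if_cong)

text \<open>\<open>S\<close> may contain points whose component is null; they carry no mass and
  would spoil the count.\<close>

definition atoms :: "complex set" where
  "atoms = {s \<in> S. 0 < weight s}"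

lemma finite_atoms [simp]: "finite atoms"
  by (simp add: atoms_def)

lemma gram_spectral:
  assumes "m \<in> deg_le (Suc k)" "m' \<in> deg_le (Suc k)"
  shows "gram \<gamma> m m' = (\<Sum>s\<in>atoms. of_real (weight s) * monom_at s m * cnj (monom_at s m'))"
proof -
  have "gram \<gamma> m m' = (\<Sum>s\<in>S. monom_at s m * cnj (ip (c m') (e s)))"
    using assms by (simp add: ip_c_c[symmetric] ip_c_spectral[OF assms(1)] ip_hermitian[of "e _" "c m'"])
  also have "\<dots> = (\<Sum>s\<in>S. of_real (weight s) * monom_at s m * cnj (monom_at s m'))"
    using assms by (intro sum.cong refl) (simp add: ip_c_e)
  also have "\<dots> = (\<Sum>s\<in>atoms. of_real (weight s) * monom_at s m * cnj (monom_at s m'))"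
  proof (rule sum.mono_neutral_right)
    show "\<forall>s\<in>S - atoms. of_real (weight s) * monom_at s m * cnj (monom_at s m') = 0"
      using weight_nonneg by (auto simp: atoms_def less_le)
  qed (auto simp: atoms_def)
  finally show ?thesis .
qed

lemma moment_spectral:
  assumes "i + j \<le> 2 * Suc k"
  shows "\<gamma> i j = (\<Sum>s\<in>atoms. of_real (weight s) * (cnj s ^ i * s ^ j))"
proof -
  \<comment> \<open>Any monomial of degree at most \<open>2 * Suc k\<close> splits into a column
    label and a conjugated row label of degree at most \<open>Suc k\<close>: \<open>m\<close> is
    filled first, with conjugate factors preferred, and \<open>m'\<close> takes the rest with
    exponents swapped.\<close>
  define i1 where "i1 = min i (Suc k)"
  define j1 where "j1 = min j (Suc k - i1)"
  define m where "m = (i1, j1)"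
  define m' where "m' = (j - j1, i - i1)"
  have "m \<in> deg_le (Suc k)" "m' \<in> deg_le (Suc k)" and ij: "i1 \<le> i" "j1 \<le> j"
    using assms by (auto simp: deg_le_def m_def m'_def i1_def j1_def)
  then have "gram \<gamma> m m' = (\<Sum>s\<in>atoms. of_real (weight s) * monom_at s m * cnj (monom_at s m'))"
    by (intro gram_spectral)
  moreover have "monom_at s m * cnj (monom_at s m') = cnj s ^ i * s ^ j" for s
  proof -
    have "monom_at s m * cnj (monom_at s m') = (cnj s ^ i1 * cnj s ^ (i - i1)) * (s ^ j1 * s ^ (j - j1))"
      by (simp add: monom_at_def m_def m'_def mult_ac)
    then show ?thesis
      using ij by (simp flip: power_add)
  qed
  ultimately show ?thesis
    using ij by (simp add: gram_def m_def m'_def mult.assoc)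
qed

text \<open>Compared with a column basis \<open>J\<close>: with fewer atoms, some nonzero
  combination of monomials in \<open>J\<close> vanishes at every atom and is a column dependence;
  with more, some nonzero combination of evaluations at the atoms kills \<open>J\<close>, hence all
  monomials, against orthogonality of the \<open>e s\<close>.\<close>

lemma card_atoms: "card atoms = mat_rank (moment_matrix (Suc k) \<gamma>)"
proof -
  obtain J where J: "J \<subseteq> deg_le (Suc k)" "card J = mat_rank (moment_matrix (Suc k) \<gamma>)"
    and indep: "\<And>a. (\<forall>m'\<in>deg_le (Suc k). (\<Sum>m\<in>J. a m * gram \<gamma> m m') = 0) \<Longrightarrow> \<forall>m\<in>J. a m = 0"
    and span: "\<And>m. m \<in> deg_le (Suc k) \<Longrightarrow>
      \<exists>a. \<forall>m'\<in>deg_le (Suc k). gram \<gamma> m m' = (\<Sum>j\<in>J. a j * gram \<gamma> j m')"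
    using moment_matrix_column_basis[of "Suc k" \<gamma>] by blast
  have finJ: "finite J"
    using J(1) finite_deg_le finite_subset by blast
  have "\<not> card atoms < card J"
  proof
    assume "card atoms < card J"
    then obtain a where a: "\<exists>j\<in>J. a j \<noteq> 0" "\<And>s. s \<in> atoms \<Longrightarrow> (\<Sum>j\<in>J. a j * monom_at s j) = 0"
      using homogeneous_system_nontrivial[of atoms J monom_at] finJ by auto
    have "(\<Sum>m\<in>J. a m * gram \<gamma> m m') = 0" if "m' \<in> deg_le (Suc k)" for m'
    proof -
      have "(\<Sum>m\<in>J. a m * gram \<gamma> m m') =
          (\<Sum>m\<in>J. \<Sum>s\<in>atoms. a m * monom_at s m * (of_real (weight s) * cnj (monom_at s m')))"
        using J(1) that by (intro sum.cong refl) (auto simp: gram_spectral sum_distrib_left mult_ac)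
      also have "\<dots> = (\<Sum>s\<in>atoms. (\<Sum>m\<in>J. a m * monom_at s m) * (of_real (weight s) * cnj (monom_at s m')))"
        by (subst sum.swap) (simp only: sum_distrib_right)
      finally show ?thesis
        by (simp add: a(2))
    qed
    with indep a(1) show False
      by blast
  qed
  moreover have "\<not> card J < card atoms"
  proof
    assume "card J < card atoms"
    then obtain b where b: "\<exists>s\<in>atoms. b s \<noteq> 0" "\<And>j. j \<in> J \<Longrightarrow> (\<Sum>s\<in>atoms. b s * monom_at s j) = 0"
      using homogeneous_system_nontrivial[of J atoms "\<lambda>j s. monom_at s j"] finJ by auto
    \<comment> \<open>The conjugate and the division by the weight cancel those produced by
      \<open>ip_lincomb_right\<close> and \<open>ip_c_e\<close>, so pairing with this vector
      evaluates the combination \<open>b\<close>.\<close>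
    define q where "q s = cnj (b s / of_real (weight s))" for s
    have q: "ip (c m) (\<lambda>x. \<Sum>s\<in>atoms. q s * e s x) = (\<Sum>s\<in>atoms. b s * monom_at s m)"
      if "m \<in> deg_le (Suc k)" for m
      unfolding ip_lincomb_right using that
      by (intro sum.cong refl) (auto simp: q_def ip_c_e atoms_def)
    have "(\<Sum>s\<in>atoms. b s * monom_at s m) = 0" if m: "m \<in> deg_le (Suc k)" for m
    proof -
      obtain a where a: "\<And>m'. m' \<in> deg_le (Suc k) \<Longrightarrow> gram \<gamma> m m' = (\<Sum>j\<in>J. a j * gram \<gamma> j m')"
        using span[OF m] by blast
      have "ip (c m) z = (\<Sum>j\<in>J. a j * ip (c j) z)" for z
      proof -
        have "ip (c m) z = (\<Sum>b\<in>deg_le k. \<Sum>j\<in>J. a j * (cnj (z b) * gram \<gamma> j b))"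
          by (simp add: ip_c[OF m] a sum_distrib_left mult_ac)
        also have "\<dots> = (\<Sum>j\<in>J. a j * (\<Sum>b\<in>deg_le k. cnj (z b) * gram \<gamma> j b))"
          by (subst sum.swap) (simp only: sum_distrib_left)
        also have "\<dots> = (\<Sum>j\<in>J. a j * ip (c j) z)"
          using J(1) by (intro sum.cong refl arg_cong2[of _ _ _ _ times]) (auto intro!: ip_c[symmetric])
        finally show ?thesis .
      qed
      then have "ip (c m) (\<lambda>x. \<Sum>s\<in>atoms. q s * e s x) = (\<Sum>j\<in>J. a j * ip (c j) (\<lambda>x. \<Sum>s\<in>atoms. q s * e s x))" .
      also have "\<dots> = 0"
        using J(1) q b(2) by (intro sum.neutral) auto
      finally show ?thesis
        using q[OF m] by simp
    qed
    \<comment> \<open>Every vector is, modulo \<open>null\<close>, a combination of the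
      \<open>c m\<close>, so \<open>q\<close> gives a vector orthogonal to all.\<close>
    then have 0: "ip (e t) (\<lambda>x. \<Sum>s\<in>atoms. q s * e s x) = 0" for t
      by (simp add: ip_expand[of "e t"] q)
    have "b t = 0" if t: "t \<in> atoms" for t
    proof -
      have "0 = (\<Sum>s\<in>atoms. cnj (q s) * ip (e t) (e s))"
        using 0[of t] unfolding ip_lincomb_right by simp
      also have "\<dots> = (\<Sum>s\<in>atoms. if t = s then cnj (q s) * of_real (weight t) else 0)"
        using t by (intro sum.cong refl) (auto simp: ip_e atoms_def)
      also have "\<dots> = b t"
        using t by (auto simp: q_def atoms_def)
      finally show ?thesis
        by simp
    qed
    with b(1) show False
      by blast
  qed
  ultimately show ?thesis
    using J(2) by simp
qed

end

section \<open>Representing measures\<close>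

context flat_spectrum
begin

text \<open>The point measure lives on the power set of \<open>atoms\<close>; pushing it forward
  along the inclusion gives a Borel measure on the plane.\<close>

definition atomic_measure :: "complex measure" where
  "atomic_measure = distr (point_measure atoms (\<lambda>s. ennreal (weight s))) borel (\<lambda>z. z)"

lemma sets_atomic_measure [simp]: "sets atomic_measure = sets borel"
  by (simp add: atomic_measure_def)

lemma emeasure_atomic_measure:
  assumes "B \<in> sets borel"
  shows "emeasure atomic_measure B = (\<Sum>s\<in>atoms. ennreal (weight s) * indicator B s)"
proof -
  have "emeasure atomic_measure B = emeasure (point_measure atoms (\<lambda>s. ennreal (weight s))) (B \<inter> atoms)"
    using assms by (simp add: atomic_measure_def emeasure_distr space_point_measure)
  also have "\<dots> = (\<Sum>s\<in>B \<inter> atoms. ennreal (weight s))"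
    by (rule emeasure_point_measure_finite2) auto
  also have "\<dots> = (\<Sum>s\<in>atoms. ennreal (weight s) * indicator B s)"
    by (rule sum.mono_neutral_cong_left) (auto simp: indicator_def)
  finally show ?thesis .
qed

lemma atomic_atomic_measure: "atomic (card atoms) atomic_measure"
  unfolding atomic_def
  by (intro conjI exI[of _ atoms] exI[of _ weight]) (auto simp: atoms_def emeasure_atomic_measure)

lemma representing_atomic_measure: "representing_measure (Suc k) \<gamma> atomic_measure"
  unfolding representing_measure_def
proof (intro conjI allI impI)
  fix i j :: nat assume ij: "i + j \<le> 2 * Suc k"
  let ?M = "point_measure atoms (\<lambda>s. ennreal (weight s))"
  have meas: "(\<lambda>z. z) \<in> measurable ?M (borel :: complex measure)"
    by simp
  have f: "(\<lambda>z. cnj z ^ i * z ^ j) \<in> borel_measurable (borel :: complex measure)"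
    by (intro borel_measurable_continuous_onI continuous_intros)
  show "integrable atomic_measure (\<lambda>z. cnj z ^ i * z ^ j)"
    unfolding atomic_measure_def integrable_distr_eq[OF meas f]
    by (rule integrable_point_measure_finite) simp
  have "(\<integral>z. cnj z ^ i * z ^ j \<partial>atomic_measure) = (\<Sum>s\<in>atoms. weight s *\<^sub>R (cnj s ^ i * s ^ j))"
    unfolding atomic_measure_def integral_distr[OF meas f]
    by (rule lebesgue_integral_point_measure_finite) (auto simp: weight_nonneg)
  then show "\<gamma> i j = (\<integral>z. cnj z ^ i * z ^ j \<partial>atomic_measure)"
    using moment_spectral[OF ij] by (simp add: scaleR_conv_of_real)
qed simp

section \<open>Uniqueness: polynomial relations almost everywhere\<close>

definition eval :: "(nat \<times> nat \<Rightarrow> complex) \<Rightarrow> complex \<Rightarrow> complex" where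
  "eval p z = (\<Sum>b\<in>deg_le k. p b * monom_at z b)"

lemma eval_diff: "eval (p - q) z = eval p z - eval q z"
  by (simp add: eval_def fun_diff_def left_diff_distrib sum_subtractf)

lemma eval_scale: "eval (\<lambda>x. a * p x) z = a * eval p z"
  by (simp add: eval_def sum_distrib_left mult.assoc)

lemma eval_sum: "eval (\<Sum>s\<in>A. f s) z = (\<Sum>s\<in>A. eval (f s) z)"
  by (induction A rule: infinite_finite_induct) (simp_all add: eval_def distrib_right sum.distrib)

lemma eval_measurable [measurable]: "eval p \<in> borel_measurable borel"
  unfolding eval_def monom_at_def by (intro borel_measurable_continuous_onI continuous_intros)

lemma eval_T: "eval (T p) z = (\<Sum>a\<in>deg_le k. p a * eval (c (Z_times a)) z)"
proof -
  have "eval (T p) z = (\<Sum>b\<in>deg_le k. \<Sum>a\<in>deg_le k. p a * (c (Z_times a) b * monom_at z b))"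
    by (simp add: eval_def T_def sum_distrib_right mult.assoc)
  also have "\<dots> = (\<Sum>a\<in>deg_le k. p a * eval (c (Z_times a)) z)"
    by (subst sum.swap) (simp add: eval_def sum_distrib_left)
  finally show ?thesis .
qed

context
  fixes \<nu> :: "complex measure"
  assumes rep: "representing_measure (Suc k) \<gamma> \<nu>"
begin

lemma sets_rep [measurable_cong]: "sets \<nu> = sets borel"
  using rep by (simp add: representing_measure_def)

lemma has_bochner_moment:
  "i + j \<le> 2 * Suc k \<Longrightarrow> has_bochner_integral \<nu> (\<lambda>z. cnj z ^ i * z ^ j) (\<gamma> i j)"
  using rep unfolding representing_measure_def has_bochner_integral_iff by metis

text \<open>The square expands into monomials of degree at most \<open>2 * Suc k\<close>, whose
  integrals are prescribed. Leaving \<open>A\<close> open covers both \<open>eval\<close>, with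
  degree at most \<open>k\<close>, and relations of degree \<open>Suc k\<close>.\<close>

lemma square_integral:
  assumes "A \<subseteq> deg_le (Suc k)"
  shows "has_bochner_integral \<nu> (\<lambda>z. (norm (\<Sum>m\<in>A. p m * monom_at z m))\<^sup>2)
    (Re (\<Sum>m\<in>A. \<Sum>m'\<in>A. p m * cnj (p m') * gram \<gamma> m m'))"
proof -
  have "has_bochner_integral \<nu> (\<lambda>z. monom_at z m * cnj (monom_at z m')) (gram \<gamma> m m')"
    if "m \<in> A" "m' \<in> A" for m m'
  proof -
    have deg: "(fst m + snd m') + (snd m + fst m') \<le> 2 * Suc k"
      using subsetD[OF assms that(1)] subsetD[OF assms that(2)] by (auto simp: deg_le_def)
    have "monom_at z m * cnj (monom_at z m') = cnj z ^ (fst m + snd m') * z ^ (snd m + fst m')" for z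
      by (simp add: monom_at_def power_add mult_ac)
    then show ?thesis
      using has_bochner_moment[OF deg] by (simp only: gram_def)
  qed
  then have "has_bochner_integral \<nu>
      (\<lambda>z. \<Sum>m\<in>A. \<Sum>m'\<in>A. p m * cnj (p m') * (monom_at z m * cnj (monom_at z m')))
      (\<Sum>m\<in>A. \<Sum>m'\<in>A. p m * cnj (p m') * gram \<gamma> m m')"
    by (intro has_bochner_integral_sum has_bochner_integral_mult_right)
  from has_bochner_integral_bounded_linear[OF bounded_linear_Re this]
  have "has_bochner_integral \<nu>
      (\<lambda>z. Re (\<Sum>m\<in>A. \<Sum>m'\<in>A. p m * cnj (p m') * (monom_at z m * cnj (monom_at z m'))))
      (Re (\<Sum>m\<in>A. \<Sum>m'\<in>A. p m * cnj (p m') * gram \<gamma> m m'))" .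
  moreover have "Re (\<Sum>m\<in>A. \<Sum>m'\<in>A. p m * cnj (p m') * (monom_at z m * cnj (monom_at z m'))) =
      (norm (\<Sum>m\<in>A. p m * monom_at z m))\<^sup>2" for z
  proof -
    let ?w = "\<Sum>m\<in>A. p m * monom_at z m"
    have "(\<Sum>m\<in>A. \<Sum>m'\<in>A. p m * cnj (p m') * (monom_at z m * cnj (monom_at z m'))) = ?w * cnj ?w"
      by (simp add: sum_product mult_ac)
    then show ?thesis
      by (simp only: complex_norm_square[symmetric] Re_complex_of_real)
  qed
  ultimately show ?thesis
    by (simp only:)
qed

lemma AE_zero:
  assumes "A \<subseteq> deg_le (Suc k)"
    and "(\<Sum>m\<in>A. \<Sum>m'\<in>A. p m * cnj (p m') * gram \<gamma> m m') = 0"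
  shows "AE z in \<nu>. (\<Sum>m\<in>A. p m * monom_at z m) = 0"
proof -
  have int: "integrable \<nu> (\<lambda>z. (norm (\<Sum>m\<in>A. p m * monom_at z m))\<^sup>2)"
    and "(\<integral>z. (norm (\<Sum>m\<in>A. p m * monom_at z m))\<^sup>2 \<partial>\<nu>) = 0"
    using square_integral[OF assms(1), of p] assms(2) by (auto simp: has_bochner_integral_iff)
  then have "AE z in \<nu>. (norm (\<Sum>m\<in>A. p m * monom_at z m))\<^sup>2 = 0"
    using integral_nonneg_eq_0_iff_AE[OF int] by simp
  then show ?thesis
    by simp
qed

lemma AE_eval_null:
  assumes "null p"
  shows "AE z in \<nu>. eval p z = 0"
  unfolding eval_def using assms
  by (intro AE_zero) (auto simp: null_def ip_def)

lemma AE_eval_c: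
  assumes m: "m \<in> deg_le (Suc k)"
  shows "AE z in \<nu>. monom_at z m = eval (c m) z"
proof -
  \<comment> \<open>Coefficients of the difference of the monomial \<open>m\<close> and its
    reduction \<open>c m\<close>. By \<open>reduce\<close> this vector lies in the kernel of the
    moment matrix.\<close>
  define p where "p x = (if x = m then 1 else 0) - (if x \<in> deg_le k then c m x else 0)" for x
  have split: "(\<Sum>x\<in>deg_le (Suc k). p x * f x) = f m - (\<Sum>b\<in>deg_le k. c m b * f b)" for f
  proof -
    have "(\<Sum>x\<in>deg_le (Suc k). p x * f x) =
        (\<Sum>x\<in>deg_le (Suc k). (if x = m then f x else 0)) -
        (\<Sum>x\<in>deg_le (Suc k). (if x \<in> deg_le k then c m x * f x else 0))"
      unfolding sum_subtractf[symmetric] by (intro sum.cong refl) (simp add: p_def algebra_simps)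
    also have "(\<Sum>x\<in>deg_le (Suc k). (if x = m then f x else 0)) = f m"
      using m by simp
    also have "(\<Sum>x\<in>deg_le (Suc k). (if x \<in> deg_le k then c m x * f x else 0)) = (\<Sum>b\<in>deg_le k. c m b * f b)"
      by (rule sum.mono_neutral_cong_right) auto
    finally show ?thesis .
  qed
  have "AE z in \<nu>. (\<Sum>x\<in>deg_le (Suc k). p x * monom_at z x) = 0"
  proof (rule AE_zero)
    have "(\<Sum>a\<in>deg_le (Suc k). \<Sum>b\<in>deg_le (Suc k). p a * cnj (p b) * gram \<gamma> a b) =
        (\<Sum>b\<in>deg_le (Suc k). cnj (p b) * (\<Sum>a\<in>deg_le (Suc k). p a * gram \<gamma> a b))"
      by (subst sum.swap) (simp add: sum_distrib_left mult_ac)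
    also have "\<dots> = 0"
      by (rule sum.neutral) (simp add: split reduce[OF m])
    finally show "(\<Sum>a\<in>deg_le (Suc k). \<Sum>b\<in>deg_le (Suc k). p a * cnj (p b) * gram \<gamma> a b) = 0" .
  qed simp
  then show ?thesis
    by (simp add: split eval_def)
qed

text \<open>Finitely many relations hold together off one null set; at a point \<open>z\<close>
  outside it the rest is algebra.\<close>

lemma AE_eval_e:
  "AE z in \<nu>. z \<in> S \<and> (\<forall>s\<in>S. eval (e s) z = (if z = s then 1 else 0))"
proof -
  have one: "AE z in \<nu>. eval (c (0, 0) - (\<Sum>s\<in>S. e s)) z = 0"
    by (rule AE_eval_null[OF decomp])
  have eigenpoly: "AE z in \<nu>. \<forall>s\<in>S. eval (\<lambda>x. T (e s) x - s * e s x) z = 0"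
    using eigen by (intro AE_finite_allI) (auto simp: eigenvector_def fun_diff_def intro: AE_eval_null)
  have red: "AE z in \<nu>. \<forall>m\<in>deg_le (Suc k). monom_at z m = eval (c m) z"
    by (intro AE_finite_allI AE_eval_c) auto
  from one eigenpoly red show ?thesis
  proof eventually_elim
    case (elim z)
    have "eval (c (0, 0)) z = 1"
      using elim(3)[rule_format, of "(0, 0)"] by (simp add: deg_le_def monom_at_def)
    with elim(1) have sum1: "(\<Sum>s\<in>S. eval (e s) z) = 1"
      by (simp add: eval_diff eval_sum)
    have zero: "eval (e s) z = 0" if "s \<in> S" "z \<noteq> s" for s
    proof -
      \<comment> \<open>At such a \<open>z\<close> reduction preserves values, so \<open>T\<close>
        is true multiplication by \<open>z\<close>.\<close>
      have "eval (T (e s)) z = (\<Sum>a\<in>deg_le k. e s a * monom_at z (Z_times a))"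
        unfolding eval_T using elim(3) by (intro sum.cong refl) simp
      also have "\<dots> = z * eval (e s) z"
        by (simp add: eval_def monom_at_def sum_distrib_left mult_ac)
      finally have "(z - s) * eval (e s) z = eval (\<lambda>x. T (e s) x - s * e s x) z"
        using eval_diff[of "T (e s)" "\<lambda>x. s * e s x" z]
        by (simp add: fun_diff_def eval_scale left_diff_distrib)
      then show ?thesis
        using elim(2) that by simp
    qed
    have z: "z \<in> S"
    proof (rule ccontr)
      assume "z \<notin> S"
      then have "(\<Sum>s\<in>S. eval (e s) z) = 0"
        by (intro sum.neutral ballI zero) auto
      with sum1 show False
        by simp
    qed
    have "(\<Sum>s\<in>S - {z}. eval (e s) z) = 0"
      by (intro sum.neutral ballI zero) auto
    then have "eval (e z) z = 1"
      using sum1 sum.remove[OF finite_S z, of "\<lambda>s. eval (e s) z"] by simp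
    with z show ?case
      using zero by auto
  qed
qed

text \<open>Almost everywhere \<open>eval (e s)\<close> is the indicator of \<open>{s}\<close>, so
  the mass of \<open>s\<close> is the integral of its squared modulus, which the moments determine
  as \<open>ip (e s) (e s)\<close>.\<close>

lemma emeasure_rep_singleton:
  assumes "s \<in> S"
  shows "emeasure \<nu> {s} = ennreal (weight s)"
proof -
  \<comment> \<open>The moment of index (0, 0) makes \<open>\<nu>\<close> finite.\<close>
  have "integrable \<nu> (\<lambda>_. 1 :: complex)"
    using has_bochner_moment[of 0 0] by (simp add: has_bochner_integral_iff)
  then interpret finite_measure \<nu>
    by (intro finite_measureI) (simp add: integrable_iff_bounded less_top)
  have "has_bochner_integral \<nu> (\<lambda>z. (norm (eval (e s) z))\<^sup>2) (weight s)"
    unfolding eval_def weight_def ip_def by (rule square_integral) auto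
  then have "weight s = (\<integral>z. (norm (eval (e s) z))\<^sup>2 \<partial>\<nu>)"
    by (simp add: has_bochner_integral_iff)
  also have "\<dots> = (\<integral>z. indicator {s} z \<partial>\<nu>)"
  proof (rule integral_cong_AE)
    show "AE z in \<nu>. (norm (eval (e s) z))\<^sup>2 = indicator {s} z"
      using AE_eval_e by eventually_elim (use assms in auto)
  qed measurable
  also have "\<dots> = measure \<nu> {s}"
    using sets_eq_imp_space_eq[OF sets_rep] by simp
  finally show ?thesis
    by (simp add: emeasure_eq_measure)
qed

text \<open>A measure concentrated on the finite set \<open>S\<close> is determined by the masses of
  its points.\<close>

lemma representing_unique: "\<nu> = atomic_measure"
proof (rule measure_eqI)
  fix B assume "B \<in> sets \<nu>"
  then have B: "B \<in> sets borel"
    by (simp add: sets_rep)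
  have "emeasure \<nu> B = emeasure \<nu> (B \<inter> S)"
  proof (rule emeasure_eq_AE)
    show "AE z in \<nu>. z \<in> B \<longleftrightarrow> z \<in> B \<inter> S"
      using AE_eval_e by eventually_elim auto
    have "S \<in> sets borel"
      by (intro borel_closed finite_imp_closed) simp
    then show "B \<in> sets \<nu>" "B \<inter> S \<in> sets \<nu>"
      using B by (auto simp: sets_rep)
  qed
  also have "\<dots> = (\<Sum>s\<in>B \<inter> S. emeasure \<nu> {s})"
    by (rule emeasure_eq_sum_singleton) (auto simp: sets_rep)
  also have "\<dots> = (\<Sum>s\<in>B \<inter> S. ennreal (weight s))"
    by (intro sum.cong refl) (simp add: emeasure_rep_singleton)
  also have "\<dots> = (\<Sum>s\<in>S. ennreal (weight s) * indicator B s)"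
    by (rule sum.mono_neutral_cong_left) (auto simp: indicator_def)
  also have "\<dots> = (\<Sum>s\<in>atoms. ennreal (weight s) * indicator B s)"
    by (rule sum.mono_neutral_right) (auto simp: atoms_def ennreal_neg not_less)
  finally show "emeasure \<nu> B = emeasure atomic_measure B"
    using B by (simp add: emeasure_atomic_measure)
qed (simp add: sets_rep)

end

end

theorem proposition4p1:
  fixes n :: nat and \<gamma> :: "nat \<Rightarrow> nat \<Rightarrow> complex"
  assumes "n \<ge> 1"
    and "flat n \<gamma>"
  shows "\<exists>\<mu>. representing_measure n \<gamma> \<mu> \<and>
             (\<forall>\<nu>. representing_measure n \<gamma> \<nu> \<longrightarrow> \<nu> = \<mu>) \<and>
             atomic (mat_rank (moment_matrix n \<gamma>)) \<mu>"
proof -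
  \<comment> \<open>Reductions go to degree at most \<open>n - 1\<close>, which is
    \<open>k\<close>.\<close>
  from assms(1) obtain k where n: "n = Suc k"
    by (cases n) auto
  have psd: "pos_semidefinite (moment_matrix (Suc k) \<gamma>)"
    and rank: "mat_rank (moment_matrix (Suc k) \<gamma>) = mat_rank (moment_matrix k \<gamma>)"
    using assms(2) by (simp_all add: flat_def n)
  have "\<forall>m. \<exists>c. m \<in> deg_le (Suc k) \<longrightarrow>
      (\<forall>m'\<in>deg_le (Suc k). gram \<gamma> m m' = (\<Sum>b\<in>deg_le k. c b * gram \<gamma> b m'))"
    using column_reduction[OF _ rank] by auto
  then obtain c where c: "\<And>m m'. m \<in> deg_le (Suc k) \<Longrightarrow> m' \<in> deg_le (Suc k) \<Longrightarrow>
      gram \<gamma> m m' = (\<Sum>b\<in>deg_le k. c m b * gram \<gamma> b m')"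
    by metis
  interpret flat_moments k \<gamma> c
    using pos_semidefinite_gram[OF psd] c by unfold_locales
  obtain S e where "finite S" "\<forall>s\<in>S. eigenvector s (e s)" "null (c (0, 0) - (\<Sum>s\<in>S. e s))"
    using ex_eigenvector_decomposition by blast
  then interpret flat_spectrum k \<gamma> c S e
    by unfold_locales auto
  show ?thesis
    using representing_atomic_measure representing_unique atomic_atomic_measure
    unfolding n card_atoms by blast
qed

end
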